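(* Let $x_1,\dots,x_n\in\mathbb{R}$. Let us fix distinct numbers $\lambda_1,\dots,\lambda_n\in\mathbb{R}$. The volume of the permutohedron $P_n=P_n(x_1,\dots,x_n)$ is equal to $$\mathrm{Vol}\,P_n=\frac{1}{(n-1)!}\sum_{w\in S_n}\frac{(\lambda_{w(1)}x_1+\cdots+\lambda_{w(n)}x_n)^{n-1}}{(\lambda_{w(1)}-\lambda_{w(2)})(\lambda_{w(2)}-\lambda_{w(3)})\cdots(\lambda_{w(n-1)}-\lambda_{w(n)})}.$$
   Context: $S_n$ is the symmetric group on $\{1,\dots,n\}$. For $x_1,\dots,x_n\in\mathbb{R}$, the permutohedron $P_n(x_1,\dots,x_n)\subset\mathbb{R}^n$ is the convex hull of the points $(x_{w(1)},\dots,x_{w(n)})$, $w\in S_n$. It lies in the hyperplane $t_1+\cdots+t_n=x_1+\cdots+x_n$. For a polytope $P$ contained in a hyperplane $t_1+\cdots+t_n=c$, $\mathrm{Vol}\,P$ denotes the usual $(n-1)$-dimensional volume of the image of $P$ under the projection $(t_1,\dots,t_n)\mapsto(t_1,\dots,t_{n-1})$.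
   Formalization: The numbers are assumed to be listed in weakly decreasing order, x_1 ≥ … ≥ x_n; for arbitrary order the formula fails (n = 2, x = (0,1): the right side is x_1 − x_2 = −1, the volume is 1). Every permutohedron has such a listing. *)

theory Defs
  imports
    "HOL-Analysis.Analysis"
    "HOL-Combinatorics.Permutations"
    "HOL-Library.Function_Algebras"
begin

text \<open>
  The dimension \<open>n\<close> varies and the volume relates \<open>\<real>\<^sup>n\<close> to \<open>\<real>\<^sup>n\<^sup>-\<^sup>1\<close>, so \<open>\<real>\<^sup>n\<close> is rendered as
  the extensional functions \<open>{1..n} \<rightarrow>\<^sub>E UNIV :: (nat \<Rightarrow> real) set\<close>. Pointwise scaling, together
  with the pointwise addition of \<open>HOL-Library.Function_Algebras\<close>, makes the library's
  \<open>convex hull\<close> available for sets of such functions; a convex combination of extensional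
  functions is again extensional, because the common value \<open>undefined\<close> outside \<open>{1..n}\<close> is kept.
\<close>

instantiation "fun" :: (type, real_vector) real_vector
begin

definition scaleR_fun_def: "scaleR r f = (\<lambda>i. r *\<^sub>R f i)"

instance
  by standard (simp_all add: scaleR_fun_def fun_eq_iff scaleR_add_left scaleR_add_right)

end

definition permutohedron :: "nat \<Rightarrow> (nat \<Rightarrow> real) \<Rightarrow> (nat \<Rightarrow> real) set" where
  "permutohedron n x =
     convex hull {(\<lambda>i\<in>{1..n}. x (w i)) | w. w permutes {1..n}}"

text \<open>
  For \<open>P\<close> in a hyperplane \<open>t\<^sub>1 + \<dots> + t\<^sub>n = c\<close>: Lebesgue measure on \<open>\<real>\<^sup>n\<^sup>-\<^sup>1\<close> of the image of \<open>P\<close>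
  under forgetting the last coordinate. For \<open>n = 1\<close> the measure space is the one-point
  \<open>\<real>\<^sup>0\<close> with total mass 1.
\<close>

definition proj_volume :: "nat \<Rightarrow> (nat \<Rightarrow> real) set \<Rightarrow> real" where
  "proj_volume n P =
     measure (Pi\<^sub>M {1..<n} (\<lambda>_. lborel)) ((\<lambda>t. restrict t {1..<n}) ` P)"

end

theory Submission
  imports Defs "HOL-Combinatorics.Multiset_Permutations"
begin

text \<open>
  Let \<open>x\<^sub>1 \<ge> \<dots> \<ge> x\<^sub>n\<close>. By Rado's theorem \<open>P\<^sub>n(x)\<close> consists of the points majorized by \<open>x\<close>. The
  points with last coordinate \<open>s \<in> [x\<^sub>k\<^sub>+\<^sub>1, x\<^sub>k]\<close> form \<open>P\<^sub>n\<^sub>-\<^sub>1(y)\<close>, where \<open>y\<close> arises from \<open>x\<close> by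
  replacing the two entries \<open>x\<^sub>k, x\<^sub>k\<^sub>+\<^sub>1\<close> by the single entry \<open>x\<^sub>k + x\<^sub>k\<^sub>+\<^sub>1 - s\<close>: the partial sums
  of \<open>y\<close> are \<open>Y\<^sub>j = min X\<^sub>j (X\<^sub>j\<^sub>+\<^sub>1 - s)\<close>, so both sets are cut out by the same inequalities.
  Hence \<open>Vol P\<^sub>n(x)\<close> is the sum over \<open>k\<close> of the integrals of \<open>Vol P\<^sub>n\<^sub>-\<^sub>1(y)\<close> over
  \<open>[x\<^sub>k\<^sub>+\<^sub>1, x\<^sub>k]\<close>.

  If one \<open>\<lambda>\<close> is \<open>0\<close>, the right-hand side satisfies the same recursion, with the remaining
  \<open>\<lambda>\<close>'s in the integrand. The same recursion shows inductively that the sum vanishes when the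
  exponent \<open>n - 1\<close> is lowered, which makes the right-hand side invariant under a common shift of
  the \<open>\<lambda>\<close>'s, so that one of them may be assumed to be \<open>0\<close>.
\<close>

subsection \<open>The sum over permutations\<close>

text \<open>Lists count from 0 and vectors from 1, hence the \<open>Suc i\<close>.\<close>

definition dot :: "real list \<Rightarrow> (nat \<Rightarrow> real) \<Rightarrow> real" where
  "dot ls x = (\<Sum>i<length ls. ls ! i * x (Suc i))"

definition gaps :: "real list \<Rightarrow> real" where
  "gaps ls = (\<Prod>i<length ls - 1. ls ! i - ls ! Suc i)"

text \<open>Lists enumerating the set \<open>L\<close> stand for the sequences
  \<open>l (w 1), ..., l (w n)\<close>, so that a single coefficient can be inserted or removed. The
  exponent \<open>j\<close> is independent of \<open>card L\<close> because lower powers occur in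
  the binomial expansion.\<close>

definition perm_sum :: "nat \<Rightarrow> (nat \<Rightarrow> real) \<Rightarrow> real set \<Rightarrow> real" where
  "perm_sum j x L = (\<Sum>ls\<in>permutations_of_set L. dot ls x ^ j / gaps ls)"

text \<open>
  For sorted \<open>x\<close> with \<open>x\<^sub>k\<^sub>+\<^sub>1 \<le> s \<le> x\<^sub>k\<close>, the part of the permutohedron of \<open>x\<close> where the last
  coordinate is \<open>s\<close> is the permutohedron of \<open>slice k s x\<close>.
\<close>

definition slice :: "nat \<Rightarrow> real \<Rightarrow> (nat \<Rightarrow> real) \<Rightarrow> nat \<Rightarrow> real" where
  "slice k s x = (\<lambda>i. if i < k then x i else if i = k then x k + x (Suc k) - s else x (Suc i))"

definition skip :: "nat \<Rightarrow> (nat \<Rightarrow> real) \<Rightarrow> nat \<Rightarrow> real" where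
  "skip k x = (\<lambda>i. if i \<le> k then x i else x (Suc i))"

text \<open>At either end of its interval \<open>s\<close> cancels one of the two merged entries,
  which leaves \<open>x\<close> with one entry deleted.\<close>

lemma slice_left: "slice (Suc k) (x (Suc k)) x = skip k x"
  by (auto simp: slice_def skip_def fun_eq_iff)

lemma slice_right: "slice (Suc k) (x (Suc (Suc k))) x = skip (Suc k) x"
  by (auto simp: slice_def skip_def fun_eq_iff)

section \<open>Inserting the coefficient 0 into a list\<close>

lemma gaps_Nil [simp]: "gaps [] = 1" and gaps_single [simp]: "gaps [a] = 1"
  by (simp_all add: gaps_def)

lemma gaps_Cons: "gaps (a # b # r) = (a - b) * gaps (b # r)"
  by (simp add: gaps_def prod.lessThan_Suc_shift del: prod.lessThan_Suc)

lemma gaps_append: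
  assumes "u \<noteq> []" "v \<noteq> []"
  shows "gaps (u @ v) = gaps u * (last u - hd v) * gaps v"
  using assms
proof (induction u)
  case Nil
  then show ?case by simp
next
  case (Cons a u)
  obtain b v' where "v = b # v'" using Cons.prems by (cases v) auto
  with Cons show ?case by (cases u) (auto simp: gaps_Cons)
qed

lemma gaps_nonzero: "distinct ls \<Longrightarrow> gaps ls \<noteq> 0"
  by (auto simp: gaps_def nth_eq_iff_index_eq)

text \<open>Between neighbours p and q the factor p - q becomes p * (-q), and (p - q) / (p * (-q)) =
  1/p - 1/q. At an end of the list one neighbour is missing and its reciprocal is replaced by
  0.\<close>

lemma gaps_insert_zero:
  assumes "distinct ls" "0 \<notin> set ls" "ls \<noteq> []" "k \<le> length ls"
  shows "1 / gaps (take k ls @ 0 # drop k ls) =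
    ((if k = 0 then 0 else 1 / ls ! (k - 1)) - (if k = length ls then 0 else 1 / ls ! k)) / gaps ls"
proof -
  define u v where "u = take k ls" and "v = drop k ls"
  have ls: "ls = u @ v" and k: "k = length u" using assms by (auto simp: u_def v_def)
  have nz: "a \<noteq> 0" if "a \<in> set ls" for a using that assms by metis
  consider "u = []" | "v = []" | "u \<noteq> []" "v \<noteq> []" by blast
  then have "1 / gaps (u @ 0 # v) =
    ((if u = [] then 0 else 1 / last u) - (if v = [] then 0 else 1 / hd v)) / gaps ls"
  proof cases
    case 1
    then have "v \<noteq> []" using ls assms by auto
    then show ?thesis using 1 gaps_append[of "[0]" v] ls by simp
  next
    case 2
    then have "u \<noteq> []" using ls assms by auto
    then show ?thesis using 2 gaps_append[of u "[0]"] ls by simp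
  next
    case 3
    have l: "last u \<noteq> 0" "hd v \<noteq> 0" using 3 ls nz by auto
    have "last u - hd v \<noteq> 0" "gaps u \<noteq> 0" "gaps v \<noteq> 0"
      using 3 assms(1) gaps_nonzero unfolding ls by (auto simp: disjoint_iff) (metis last_in_set list.set_sel(1))
    moreover have "gaps (u @ 0 # v) = gaps u * last u * (- hd v) * gaps v"
      using 3 gaps_append[of u "0 # v"] gaps_append[of "[0]" v] by simp
    ultimately show ?thesis using l 3 unfolding ls gaps_append[OF 3] by (simp add: field_simps)
  qed
  moreover have "u \<noteq> [] \<Longrightarrow> ls ! (k - 1) = last u" "v \<noteq> [] \<Longrightarrow> ls ! k = hd v"
    by (auto simp: ls k nth_append last_conv_nth hd_conv_nth)
  moreover have "k = 0 \<longleftrightarrow> u = []" "k = length ls \<longleftrightarrow> v = []" by (auto simp: ls k)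
  ultimately show ?thesis unfolding u_def[symmetric] v_def[symmetric] by simp
qed

lemma dot_append: "dot (u @ v) x = dot u x + dot v (\<lambda>i. x (length u + i))"
proof -
  have "dot (u @ v) x = (\<Sum>i<length u. u ! i * x (Suc i)) +
      (\<Sum>i=length u..<length u + length v. (u @ v) ! i * x (Suc i))"
    unfolding dot_def by (simp add: lessThan_atLeast0 nth_append flip: sum.atLeastLessThan_concat[of 0 "length u" "length u + length v"])
  also have "(\<Sum>i=length u..<length u + length v. (u @ v) ! i * x (Suc i)) =
     dot v (\<lambda>i. x (length u + i))"
    using sum.shift_bounds_nat_ivl[of "\<lambda>i. (u @ v) ! i * x (Suc i)" 0 "length u" "length v"]
    by (simp add: dot_def lessThan_atLeast0 nth_append add.commute)
  finally show ?thesis by (simp add: dot_def)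
qed

text \<open>The inserted 0 meets the entry \<open>x (Suc k)\<close> and removes it; the coefficients
  behind it meet the entries one place further on.\<close>

lemma dot_insert_zero:
  assumes "k \<le> length ls"
  shows "dot (take k ls @ 0 # drop k ls) x = dot ls (skip k x)"
proof -
  have "dot ls (skip k x) = dot (take k ls @ drop k ls) (skip k x)" by simp
  also have "\<dots> = dot (take k ls) (skip k x) + dot (drop k ls) (\<lambda>i. skip k x (k + i))"
    unfolding dot_append using assms by simp
  also have "dot (take k ls) (skip k x) = dot (take k ls) x"
    by (simp add: dot_def skip_def)
  also have "dot (drop k ls) (\<lambda>i. skip k x (k + i)) = dot ([0] @ drop k ls) (\<lambda>i. x (k + i))"
    unfolding dot_append by (simp add: dot_def skip_def)
  finally show ?thesis using assms by (simp add: dot_append[of "take k ls"])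
qed

lemma sum_by_parts:
  fixes f E :: "nat \<Rightarrow> real"
  shows "(\<Sum>k\<le>m. ((if k = 0 then 0 else f (k - 1)) - (if k = m then 0 else f k)) * E k) =
    (\<Sum>k<m. f k * (E (Suc k) - E k))"
proof -
  have "(\<Sum>k\<le>m. (if k = 0 then 0 else f (k - 1)) * E k) = (\<Sum>k<m. f k * E (Suc k))"
    unfolding lessThan_Suc_atMost[symmetric] sum.lessThan_Suc_shift by simp
  moreover have "(\<Sum>k\<le>m. (if k = m then 0 else f k) * E k) = (\<Sum>k<m. f k * E k)"
    unfolding lessThan_Suc_atMost[symmetric] by simp
  ultimately show ?thesis by (simp add: algebra_simps sum_subtractf)
qed

lemma sum_permutations_of_set_insert:
  assumes "finite A" "a \<notin> A"
  shows "(\<Sum>ls\<in>permutations_of_set (insert a A). f ls) =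
    (\<Sum>ls\<in>permutations_of_set A. \<Sum>k\<le>length ls. f (take k ls @ a # drop k ls))"
proof -
  let ?g = "\<lambda>(ls, k). take k ls @ a # drop k ls"
  let ?S = "SIGMA ls:permutations_of_set A. {..length ls}"
  have "bij_betw ?g ?S (permutations_of_set (insert a A))"
  proof (rule bij_betw_imageI)
    \<comment> \<open>The inverse map: deleting \<open>a\<close> recovers the list, and the number
      of entries before \<open>a\<close> is the position.\<close>
    have "(remove1 a (?g p), length (takeWhile (\<lambda>b. b \<noteq> a) (?g p))) = p"
      if "p \<in> ?S" for p
    proof -
      obtain ls k where p: "p = (ls, k)" "set ls = A" "k \<le> length ls"
        using \<open>p \<in> ?S\<close> by (auto simp: permutations_of_set_def)
      have "a \<notin> set (take k ls)" using p assms by (auto dest: in_set_takeD)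
      moreover from this have "takeWhile (\<lambda>b. b \<noteq> a) (take k ls @ a # drop k ls) = take k ls"
        by (subst takeWhile_append2) auto
      ultimately show ?thesis using p by (simp add: remove1_append)
    qed
    then show "inj_on ?g ?S"
      by (rule inj_on_inverseI)
    show "?g ` ?S = permutations_of_set (insert a A)"
    proof (intro equalityI subsetI)
      fix ys assume "ys \<in> ?g ` ?S"
      then obtain ls k where ys: "ys = take k ls @ a # drop k ls" "set ls = A" "distinct ls"
        by (auto simp: permutations_of_set_def)
      have "set (take k ls) \<union> set (drop k ls) = A" using ys by (metis append_take_drop_id set_append)
      moreover have "set (take k ls) \<inter> set (drop k ls) = {}"
        using ys by (metis append_take_drop_id distinct_append)
      ultimately show "ys \<in> permutations_of_set (insert a A)"
        using ys assms by (auto simp: permutations_of_set_def)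
    next
      fix ys assume ys: "ys \<in> permutations_of_set (insert a A)"
      then obtain u v where uv: "ys = u @ a # v"
        by (metis insertI1 permutations_of_setD(1) split_list)
      have "u @ v \<in> permutations_of_set A"
        using ys assms uv by (auto simp: permutations_of_set_def)
      then show "ys \<in> ?g ` ?S"
        by (intro image_eqI[of _ _ "(u @ v, length u)"]) (auto simp: uv)
    qed
  qed
  then have "(\<Sum>ls\<in>permutations_of_set (insert a A). f ls) = (\<Sum>p\<in>?S. f (?g p))"
    by (rule sum.reindex_bij_betw[symmetric])
  also have "\<dots> = (\<Sum>ls\<in>permutations_of_set A. \<Sum>k\<le>length ls. f (take k ls @ a # drop k ls))"
    using assms by (subst sum.Sigma) (auto simp: case_prod_unfold)
  finally show ?thesis .
qed

text \<open>
  A primitive of \<open>\<lambda>s. j * perm_sum (j - 1) (slice (Suc k) s x) L\<close>. At the two ends of the range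
  of \<open>s\<close> it involves \<open>x\<close> with one entry skipped, that is, paired with the coefficient \<open>0\<close>; inserting
  \<open>0\<close> into \<open>ls\<close> contributes a difference of reciprocals to \<open>1 / gaps\<close>, and summation by parts
  matches the two.
\<close>

definition slice_primitive :: "nat \<Rightarrow> (nat \<Rightarrow> real) \<Rightarrow> real set \<Rightarrow> nat \<Rightarrow> real \<Rightarrow> real" where
  "slice_primitive j x L k s =
     - (\<Sum>ls\<in>permutations_of_set L. dot ls (slice (Suc k) s x) ^ j / (ls ! k * gaps ls))"

text \<open>Sum over the position of 0 inside each enumeration of \<open>L\<close>. Summation by
  parts moves the difference from the reciprocals to the powers for \<open>skip (Suc k) x\<close>
  and \<open>skip k x\<close>, which are the slices at the two ends of the interval.\<close>

lemma perm_sum_insert_zero: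
  assumes "finite L" "L \<noteq> {}" "0 \<notin> L"
  shows "perm_sum j x (insert 0 L) =
    (\<Sum>k<card L. slice_primitive j x L k (x (Suc k)) - slice_primitive j x L k (x (Suc (Suc k))))"
proof -
  have "perm_sum j x (insert 0 L) =
    (\<Sum>ls\<in>permutations_of_set L. \<Sum>k\<le>length ls.
       dot (take k ls @ 0 # drop k ls) x ^ j / gaps (take k ls @ 0 # drop k ls))"
    unfolding perm_sum_def using assms by (rule_tac sum_permutations_of_set_insert) auto
  also have "\<dots> = (\<Sum>ls\<in>permutations_of_set L. \<Sum>k<card L.
      1 / ls ! k * (dot ls (skip (Suc k) x) ^ j / gaps ls - dot ls (skip k x) ^ j / gaps ls))"
  proof (rule sum.cong[OF refl])
    fix ls assume ls: "ls \<in> permutations_of_set L"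
    have len: "length ls = card L" and d: "distinct ls" "0 \<notin> set ls" "ls \<noteq> []"
      using ls assms by (auto simp: permutations_of_set_def distinct_card)
    have "(\<Sum>k\<le>length ls. dot (take k ls @ 0 # drop k ls) x ^ j / gaps (take k ls @ 0 # drop k ls)) =
      (\<Sum>k\<le>length ls. ((if k = 0 then 0 else 1 / ls ! (k - 1)) - (if k = length ls then 0 else 1 / ls ! k)) *
         (dot ls (skip k x) ^ j / gaps ls))"
    proof (rule sum.cong[OF refl])
      fix k assume k: "k \<in> {..length ls}"
      have *: "e / g = c * (e' / h)" if "1 / g = c / h" "e = e'" for c e e' g h :: real
        using that by (metis mult.commute mult.right_neutral times_divide_eq_right)
      show "dot (take k ls @ 0 # drop k ls) x ^ j / gaps (take k ls @ 0 # drop k ls) =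
        ((if k = 0 then 0 else 1 / ls ! (k - 1)) - (if k = length ls then 0 else 1 / ls ! k)) *
         (dot ls (skip k x) ^ j / gaps ls)"
        using k by (intro * gaps_insert_zero[OF d] arg_cong[of _ _ "\<lambda>a. a ^ j"] dot_insert_zero) simp_all
    qed
    then show "(\<Sum>k\<le>length ls. dot (take k ls @ 0 # drop k ls) x ^ j / gaps (take k ls @ 0 # drop k ls)) =
      (\<Sum>k<card L. 1 / ls ! k * (dot ls (skip (Suc k) x) ^ j / gaps ls - dot ls (skip k x) ^ j / gaps ls))"
      unfolding sum_by_parts[of "\<lambda>k. 1 / ls ! k"] len .
  qed
  also have "\<dots> = (\<Sum>k<card L. \<Sum>ls\<in>permutations_of_set L.
      1 / ls ! k * (dot ls (skip (Suc k) x) ^ j / gaps ls - dot ls (skip k x) ^ j / gaps ls))"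
    by (rule sum.swap)
  also have "\<dots> = (\<Sum>k<card L. slice_primitive j x L k (x (Suc k)) - slice_primitive j x L k (x (Suc (Suc k))))"
    unfolding slice_primitive_def slice_left slice_right
    by (intro sum.cong refl) (simp add: sum_negf[symmetric] sum_subtractf[symmetric] right_diff_distrib)
  finally show ?thesis .
qed

text \<open>Only the merged entry depends on \<open>s\<close>, so \<open>dot\<close> is affine in
  \<open>s\<close> with slope \<open>- ls ! k\<close>. This slope cancels the sign and the extra
  denominator in \<open>slice_primitive\<close>.\<close>

lemma dot_slice:
  assumes "k < length ls"
  shows "dot ls (slice (Suc k) s x) = dot ls (skip k x) + ls ! k * (x (Suc k) - s)"
proof -
  have "(\<Sum>i<length ls. ls ! i * slice (Suc k) s x (Suc i)) =
    (\<Sum>i<length ls. ls ! i * skip k x (Suc i) + (if i = k then ls ! k * (x (Suc k) - s) else 0))"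
    by (intro sum.cong refl) (auto simp: slice_def skip_def algebra_simps)
  then show ?thesis using assms by (simp add: dot_def sum.distrib)
qed

lemma slice_primitive_has_derivative:
  assumes "finite L" "0 \<notin> L" "k < card L"
  shows "(slice_primitive j x L k has_real_derivative
     j * perm_sum (j - 1) (slice (Suc k) s x) L) (at s)"
proof -
  have *: "((\<lambda>s. dot ls (slice (Suc k) s x) ^ j / (ls ! k * gaps ls)) has_real_derivative
     - (j * (dot ls (slice (Suc k) s x) ^ (j - 1) / gaps ls))) (at s)"
    if ls: "ls \<in> permutations_of_set L" for ls
  proof -
    have len: "k < length ls" and d: "distinct ls" "0 \<notin> set ls"
      using ls assms by (auto simp: permutations_of_set_def distinct_card)
    have "ls ! k \<noteq> 0" using len d by (metis nth_mem)
    then show ?thesis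
      unfolding dot_slice[OF len]
      by (auto intro!: derivative_eq_intros simp: gaps_nonzero[OF d(1)] field_simps)
  qed
  show ?thesis
    unfolding slice_primitive_def[abs_def] perm_sum_def
    by (rule derivative_eq_intros * | assumption | simp add: sum_distrib_left sum_negf)+
qed

lemma slice_primitive_0:
  "slice_primitive 0 x L k s = slice_primitive 0 x L k s'"
  by (simp add: slice_primitive_def)

section \<open>Shifting the coefficients, and vanishing of low powers\<close>

lemma dot_shift: "length ls = n \<Longrightarrow> dot (map ((+) c) ls) x = dot ls x + c * (\<Sum>i=1..n. x i)"
  by (simp add: dot_def distrib_right sum.distrib sum_distrib_left sum.atLeast1_atMost_eq)

lemma gaps_shift: "gaps (map ((+) c) ls) = gaps ls"
  by (auto simp: gaps_def intro!: prod.cong)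

lemma perm_sum_shift:
  assumes "finite L"
  shows "perm_sum j x ((+) c ` L) =
    (\<Sum>i\<le>j. of_nat (j choose i) * (c * (\<Sum>i=1..card L. x i)) ^ (j - i) * perm_sum i x L)"
proof -
  have "perm_sum j x ((+) c ` L) = (\<Sum>ls\<in>permutations_of_set L.
      dot (map ((+) c) ls) x ^ j / gaps (map ((+) c) ls))"
    unfolding perm_sum_def by (subst permutations_of_set_image_inj) (auto simp: sum.reindex inj_on_def)
  also have "\<dots> = (\<Sum>ls\<in>permutations_of_set L. \<Sum>i\<le>j. of_nat (j choose i) *
      (c * (\<Sum>i=1..card L. x i)) ^ (j - i) * (dot ls x ^ i / gaps ls))"
  proof (intro sum.cong refl)
    fix ls assume ls: "ls \<in> permutations_of_set L"
    have len: "length ls = card L" using ls by (auto simp: permutations_of_set_def distinct_card)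
    show "dot (map ((+) c) ls) x ^ j / gaps (map ((+) c) ls) = (\<Sum>i\<le>j. of_nat (j choose i) *
      (c * (\<Sum>i=1..card L. x i)) ^ (j - i) * (dot ls x ^ i / gaps ls))"
      unfolding dot_shift[OF len] gaps_shift binomial_ring sum_divide_distrib
      by (simp add: mult_ac)
  qed
  also have "\<dots> = (\<Sum>i\<le>j. of_nat (j choose i) * (c * (\<Sum>i=1..card L. x i)) ^ (j - i) * perm_sum i x L)"
    unfolding perm_sum_def sum_distrib_left by (rule sum.swap)
  finally show ?thesis .
qed

text \<open>Induction on the number of coefficients. Once one of them is shifted to 0, the sum is a
  sum of increments of \<open>slice_primitive\<close>. Its derivative is a multiple of a sum with
  one coefficient and one power less, which vanishes, so the increments are 0.\<close>

lemma perm_sum_vanish: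
  assumes "finite L" "Suc j < card L"
  shows "perm_sum j x L = 0"
  using assms
proof (induction "card L" arbitrary: L j x)
  case 0
  then show ?case by simp
next
  case (Suc m)
  then obtain a where a: "a \<in> L" by (metis card.empty equals0I nat.distinct(1))
  define L' where "L' = (+) (-a) ` (L - {a})"
  have L': "finite L'" "card L' = m" "0 \<notin> L'"
    using Suc a by (auto simp: L'_def card_image)
  have ins: "(+) (-a) ` L = insert 0 L'" using a by (auto simp: L'_def)
  have L: "L = (+) a ` insert 0 L'" unfolding ins[symmetric] by (simp add: image_image)
  have ne: "L' \<noteq> {}" using Suc L' by auto
  \<comment> \<open>All powers \<open>i\<close> up to \<open>j\<close> are needed, since shifting
    back by \<open>a\<close> mixes them.\<close>
  have zero: "perm_sum i x (insert 0 L') = 0" if "Suc i < Suc m" for i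
  proof -
    have "slice_primitive i x L' k s = slice_primitive i x L' k s'" if k: "k < m" for k s s'
    proof (cases i)
      case 0
      then show ?thesis using slice_primitive_0 by simp
    next
      case (Suc i')
      have "perm_sum i' y L' = 0" for y
        using Suc.hyps(1)[of L' i' y] Suc.hyps(2) L' Suc that \<open>Suc i < Suc m\<close> by simp
      then have "(slice_primitive i x L' k has_real_derivative 0) (at s)" for s
        using slice_primitive_has_derivative[of L' k i x s] L' k Suc by simp
      then show ?thesis by (metis DERIV_const_ratio_const DERIV_isconst_all)
    qed
    then show ?thesis unfolding perm_sum_insert_zero[OF L'(1) ne L'(3)] L'(2)
      by (intro sum.neutral) simp
  qed
  show ?case unfolding L
    by (subst perm_sum_shift) (use L' zero Suc in \<open>auto intro!: sum.neutral\<close>)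
qed

text \<open>The lower powers in the binomial expansion vanish.\<close>

lemma perm_sum_shift_top:
  assumes "finite L" "card L = Suc j"
  shows "perm_sum j x ((+) c ` L) = perm_sum j x L"
proof -
  have "perm_sum j x ((+) c ` L) = (\<Sum>i\<le>j. if i = j then perm_sum j x L else 0)"
    unfolding perm_sum_shift[OF assms(1)]
    by (intro sum.cong refl) (use assms in \<open>auto simp: perm_sum_vanish\<close>)
  then show ?thesis by simp
qed

text \<open>A permutation \<open>w\<close> is sent to the list \<open>l (w 1), ..., l (w n)\<close>.
  Injectivity of \<open>l\<close> makes this injective, and surjectivity follows by counting, as
  both sides have n! elements.\<close>

lemma perm_sum_eq_sum_permutes:
  assumes "inj_on l {1..n}"
  shows "perm_sum j x (l ` {1..n}) =
    (\<Sum>w | w permutes {1..n}. (\<Sum>i=1..n. l (w i) * x i) ^ j /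
       (\<Prod>i=1..<n. l (w i) - l (w (i + 1))))"
proof -
  let ?g = "\<lambda>w. map (\<lambda>i. l (w (Suc i))) [0..<n]"
  let ?P = "{w. w permutes {1..n}}"
  have eq: "w (Suc i) = v (Suc i)"
    if "w permutes {1..n}" "v permutes {1..n}" "?g w = ?g v" "i < n" for w v i
  proof -
    have "l (w (Suc i)) = l (v (Suc i))" using that(3,4) by (simp add: map_eq_conv)
    moreover have "w (Suc i) \<in> {1..n}" "v (Suc i) \<in> {1..n}"
      using that permutes_in_image[of w "{1..n}" "Suc i"] permutes_in_image[of v "{1..n}" "Suc i"] by auto
    ultimately show ?thesis using assms by (meson inj_onD)
  qed
  have inj: "inj_on ?g ?P"
  proof (rule inj_onI, rule ext)
    fix w v i assume *: "w \<in> ?P" "v \<in> ?P" "?g w = ?g v"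
    show "w i = v i"
    proof (cases "i \<in> {1..n}")
      case True
      then show ?thesis using eq[of w v "i - 1"] * by auto
    next
      case False
      then show ?thesis using * by (simp add: permutes_not_in)
    qed
  qed
  have sub: "?g ` ?P \<subseteq> permutations_of_set (l ` {1..n})"
  proof clarify
    fix w assume w: "w permutes {1..n}"
    have img: "(\<lambda>i. w (Suc i)) ` {0..<n} = {1..n}"
      using permutes_image[OF w] by (metis image_Suc_atLeastLessThan atLeastLessThanSuc_atLeastAtMost image_image One_nat_def)
    have setg: "(\<lambda>i. l (w (Suc i))) ` {0..<n} = l ` {1..n}"
      unfolding img[symmetric] image_image ..
    have "inj_on (\<lambda>i. w (Suc i)) {0..<n}"
      using permutes_inj[OF w] by (auto simp: inj_on_def dest: injD)
    then have "inj_on (l \<circ> (\<lambda>i. w (Suc i))) {0..<n}"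
      using assms img by (intro comp_inj_on) simp_all
    then show "?g w \<in> permutations_of_set (l ` {1..n})"
      by (simp add: permutations_of_set_def distinct_map o_def setg)
  qed
  have "card (?g ` ?P) = card (permutations_of_set (l ` {1..n}))"
    using inj assms by (simp add: card_image card_permutations)
  with sub have img: "?g ` ?P = permutations_of_set (l ` {1..n})"
    by (intro card_subset_eq) simp_all
  have "perm_sum j x (l ` {1..n}) = (\<Sum>w\<in>?P. dot (?g w) x ^ j / gaps (?g w))"
    unfolding perm_sum_def img[symmetric] by (rule sum.reindex[OF inj, unfolded o_def])
  also have "\<dots> = (\<Sum>w\<in>?P. (\<Sum>i=1..n. l (w i) * x i) ^ j / (\<Prod>i=1..<n. l (w i) - l (w (i + 1))))"
  proof (intro sum.cong refl)
    fix w
    have "dot (?g w) x = (\<Sum>i=1..n. l (w i) * x i)"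
      by (simp add: dot_def sum.atLeast1_atMost_eq)
    moreover have "gaps (?g w) = (\<Prod>i=1..<n. l (w i) - l (w (i + 1)))"
      by (cases n) (auto simp del: upt_Suc simp: gaps_def atLeastLessThanSuc_atLeastAtMost prod.atLeast1_atMost_eq intro!: prod.cong)
    ultimately show "dot (?g w) x ^ j / gaps (?g w) =
      (\<Sum>i=1..n. l (w i) * x i) ^ j / (\<Prod>i=1..<n. l (w i) - l (w (i + 1)))" by simp
  qed
  finally show ?thesis .
qed

subsection \<open>The permutohedron and majorization\<close>

definition psum :: "(nat \<Rightarrow> real) \<Rightarrow> nat \<Rightarrow> real" where
  "psum x k = (\<Sum>i=1..k. x i)"

lemma psum_0 [simp]: "psum x 0 = 0" and psum_Suc [simp]: "psum x (Suc k) = psum x k + x (Suc k)"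
  by (simp_all add: psum_def)

lemma psum_slice: "psum (slice (Suc k) s x) j = (if j \<le> k then psum x j else psum x (Suc j) - s)"
  by (induction j) (auto simp: slice_def le_Suc_eq)

text \<open>The minimum is decided by comparing \<open>x (Suc j)\<close> with \<open>s\<close>, and
  sortedness places this change at \<open>k\<close>. In this form one upper bound for the slice is
  equivalent to two upper bounds for \<open>x\<close>.\<close>

lemma psum_slice_eq_min:
  assumes "antimono_on {1..Suc m} x" "k < m" "s \<in> {x (Suc (Suc k))..x (Suc k)}" "j \<le> m"
  shows "psum (slice (Suc k) s x) j = min (psum x j) (psum x (Suc j) - s)"
proof (cases "j \<le> k")
  case True
  then have "x (Suc k) \<le> x (Suc j)" using assms by (intro monotone_onD[OF assms(1)]) auto
  then show ?thesis using True assms by (auto simp: psum_slice)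
next
  case False
  then have "x (Suc j) \<le> x (Suc (Suc k))" using assms by (intro monotone_onD[OF assms(1)]) auto
  then show ?thesis using False assms by (auto simp: psum_slice)
qed

text \<open>The slice interlaces with \<open>x\<close>: its entry \<open>i\<close> lies between
  \<open>x (Suc i)\<close> and \<open>x i\<close>.\<close>

lemma slice_antimono:
  assumes "antimono_on {1..Suc m} x" "k < m" "s \<in> {x (Suc (Suc k))..x (Suc k)}"
  shows "antimono_on {1..m} (slice (Suc k) s x)"
proof (rule monotone_onI)
  fix i j assume ij: "i \<in> {1..m}" "j \<in> {1..m}" "i \<le> j"
  have x: "x b \<le> x a" if "1 \<le> a" "a \<le> b" "b \<le> Suc m" for a b
    using that by (intro monotone_onD[OF assms(1)]) auto
  have "slice (Suc k) s x i \<ge> x (Suc i)" "slice (Suc k) s x i \<le> x i" if "i \<in> {1..m}" for i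
    using that assms x[of i "Suc i"] by (auto simp: slice_def)
  from this(1)[OF ij(1)] this(2)[OF ij(2)]
  show "slice (Suc k) s x j \<le> slice (Suc k) s x i"
    using x[of "Suc i" j] ij by (cases "i = j") auto
qed

lemma interval_exists:
  fixes x :: "nat \<Rightarrow> real"
  assumes "x (Suc (Suc m)) \<le> s" "s \<le> x 1"
  shows "\<exists>k\<le>m. s \<in> {x (Suc (Suc k))..x (Suc k)}"
  using assms
proof (induction m)
  case (Suc m)
  show ?case
  proof (cases "x (Suc (Suc m)) \<le> s")
    case True
    with Suc show ?thesis by (meson le_SucI)
  next
    case False
    with Suc show ?thesis by (intro exI[of _ "Suc m"]) auto
  qed
qed auto

text \<open>If \<open>J\<close> contains the largest index, the entry there is at most
  \<open>x (card J)\<close>, because \<open>card J\<close> does not exceed that index; the rest of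
  \<open>J\<close> is covered by induction.\<close>

lemma sum_le_psum:
  assumes "antimono_on {1..n} x" "J \<subseteq> {1..n}"
  shows "sum x J \<le> psum x (card J)"
  using assms
proof (induction n arbitrary: J)
  case (Suc n)
  have mono: "antimono_on {1..n} x" using Suc.prems(1) by (auto intro: monotone_on_subset)
  show ?case
  proof (cases "Suc n \<in> J")
    case True
    define J' where "J' = J - {Suc n}"
    have J: "J = insert (Suc n) J'" "Suc n \<notin> J'" "J' \<subseteq> {1..n}" using True Suc.prems(2)
      by (auto simp: J'_def)
    have fin: "finite J'" using J finite_subset by blast
    have "card J' \<le> n" using J card_mono[of "{1..n}" J'] by simp
    then have "x (Suc n) \<le> x (Suc (card J'))"
      by (intro monotone_onD[OF Suc.prems(1)]) auto
    then show ?thesis using Suc.IH[OF mono J(3)] J fin by simp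
  next
    case False
    then have "J \<subseteq> {1..n}" using Suc.prems(2) by (auto simp: le_Suc_eq subset_iff)
    then show ?thesis using Suc.IH mono by blast
  qed
qed simp

text \<open>Bounding the sums over all index sets avoids sorting \<open>t\<close> and gives linear
  conditions. For sorted \<open>x\<close>, \<open>psum x k\<close> is the sum of the
  \<open>k\<close> largest entries.\<close>

definition majorized :: "nat \<Rightarrow> (nat \<Rightarrow> real) \<Rightarrow> (nat \<Rightarrow> real) set" where
  "majorized n x = {t \<in> {1..n} \<rightarrow>\<^sub>E UNIV.
     (\<forall>I\<subseteq>{1..n}. sum t I \<le> psum x (card I)) \<and> sum t {1..n} = psum x n}"

section \<open>Rado's theorem\<close>

lemma convex_majorized: "convex (majorized n x)"
proof (rule convexI)
  fix s t :: "nat \<Rightarrow> real" and u v :: real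
  assume s: "s \<in> majorized n x" and t: "t \<in> majorized n x" and uv: "0 \<le> u" "0 \<le> v" "u + v = 1"
  have split: "sum (u *\<^sub>R s + v *\<^sub>R t) I = u * sum s I + v * sum t I" for I
    by (simp add: scaleR_fun_def sum.distrib sum_distrib_left)
  have "u * sum s I + v * sum t I \<le> psum x (card I)" if "I \<subseteq> {1..n}" for I
    using s t uv that by (intro convex_bound_le) (auto simp: majorized_def)
  moreover have "u * psum x n + v * psum x n = psum x n"
    using uv(3) by (simp flip: distrib_right)
  \<comment> \<open>The value \<open>undefined\<close> is reproduced because the weights add up to
    1.\<close>
  moreover have "(u *\<^sub>R s + v *\<^sub>R t) i = undefined" if "i \<notin> {1..n}" for i
    using s t that uv(3) by (auto simp: majorized_def PiE_iff extensional_def scaleR_fun_def simp flip: distrib_right)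
  ultimately show "u *\<^sub>R s + v *\<^sub>R t \<in> majorized n x"
    using s t unfolding majorized_def mem_Collect_eq split by (auto simp: PiE_iff extensional_def)
qed

lemma permutohedron_subset_majorized:
  assumes "antimono_on {1..n} x"
  shows "permutohedron n x \<subseteq> majorized n x"
  unfolding permutohedron_def
proof (rule hull_minimal)
  show "convex (majorized n x)" by (rule convex_majorized)
  show "{\<lambda>i\<in>{1..n}. x (w i) |w. w permutes {1..n}} \<subseteq> majorized n x"
  proof clarify
    fix w assume w: "w permutes {1..n}"
    have "sum (\<lambda>i\<in>{1..n}. x (w i)) I \<le> psum x (card I)" if I: "I \<subseteq> {1..n}" for I
    proof -
      have "sum (\<lambda>i\<in>{1..n}. x (w i)) I = (\<Sum>i\<in>I. x (w i))"
        using I by (intro sum.cong) auto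
      also have "\<dots> = sum x (w ` I)"
        using permutes_inj_on[OF w] by (simp add: sum.reindex)
      also have "\<dots> \<le> psum x (card (w ` I))"
        using assms permutes_image[OF w] I by (intro sum_le_psum[of n]) blast+
      finally show ?thesis using permutes_inj_on[OF w] by (simp add: card_image)
    qed
    moreover have "sum (\<lambda>i\<in>{1..n}. x (w i)) {1..n} = psum x n"
      using sum.permute[OF w, of x] by (simp add: psum_def o_def)
    ultimately show "(\<lambda>i\<in>{1..n}. x (w i)) \<in> majorized n x"
      by (simp add: majorized_def)
  qed
qed

text \<open>Composing \<open>x\<close> with this cycle moves the entry \<open>x k\<close> to place
  \<open>n\<close> and closes the gap.\<close>

definition cyc :: "nat \<Rightarrow> nat \<Rightarrow> nat \<Rightarrow> nat" where
  "cyc n k i = (if i < k \<or> n < i then i else if i = n then k else Suc i)"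

lemma cyc_permutes: "1 \<le> k \<Longrightarrow> k \<le> n \<Longrightarrow> cyc n k permutes {1..n}"
  by (rule inj_imp_permutes) (auto simp: cyc_def inj_on_def split: if_splits)

text \<open>
  With \<open>s\<close> between \<open>x\<^sub>k\<^sub>+\<^sub>2\<close> and \<open>x\<^sub>k\<^sub>+\<^sub>1\<close>, the vector formed by the slice followed by \<open>s\<close> is a convex
  combination of two permutations of \<open>x\<close>: move \<open>x\<^sub>k\<^sub>+\<^sub>1\<close> or \<open>x\<^sub>k\<^sub>+\<^sub>2\<close> to the end.
\<close>

lemma slice_extended_vertex:
  assumes w: "w permutes {1..Suc m}" and k: "k \<le> m" and s: "s \<in> {x (Suc (Suc k))..x (Suc k)}"
  shows "(\<lambda>i\<in>{1..Suc m}. slice (Suc k) s x (w i))(Suc (Suc m) := s) \<in> permutohedron (Suc (Suc m)) x"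
proof -
  let ?n = "Suc (Suc m)"
  let ?V = "\<lambda>v. \<lambda>i\<in>{1..?n}. x (v i)"
  obtain c where c: "0 \<le> c" "c \<le> 1" "s = (1 - c) * x (Suc (Suc k)) + c * x (Suc k)"
  proof -
    have "s \<in> closed_segment (x (Suc (Suc k))) (x (Suc k))"
      using s by (simp add: closed_segment_eq_real_ivl)
    then show ?thesis using that unfolding closed_segment_def by auto
  qed
  \<comment> \<open>The merged entry uses the same weights exchanged, so a single \<open>c\<close>
    serves both coordinates.\<close>
  have sum': "x (Suc k) + x (Suc (Suc k)) - s = (1 - c) * x (Suc k) + c * x (Suc (Suc k))"
    unfolding c(3) by (simp add: algebra_simps)
  have wn: "w permutes {1..?n}" using w by (rule permutes_subset) auto
  have V: "?V (cyc ?n (Suc j) \<circ> w) \<in> permutohedron ?n x" if "j \<le> Suc m" for j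
    unfolding permutohedron_def using that
    by (intro hull_inc CollectI exI[of _ "cyc ?n (Suc j) \<circ> w"] conjI permutes_compose[OF wn] cyc_permutes) auto
  have "(\<lambda>i\<in>{1..Suc m}. slice (Suc k) s x (w i))(?n := s) =
    (1 - c) *\<^sub>R ?V (cyc ?n (Suc (Suc k)) \<circ> w) + c *\<^sub>R ?V (cyc ?n (Suc k) \<circ> w)"
  proof
    fix i
    consider "i \<in> {1..Suc m}" | "i = ?n" | "i \<notin> {1..?n}" by force
    then show "((\<lambda>i\<in>{1..Suc m}. slice (Suc k) s x (w i))(?n := s)) i =
      ((1 - c) *\<^sub>R ?V (cyc ?n (Suc (Suc k)) \<circ> w) + c *\<^sub>R ?V (cyc ?n (Suc k) \<circ> w)) i"
    proof cases
      case 1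
      then have "w i \<in> {1..Suc m}" using permutes_in_image[OF w] by blast
      then show ?thesis using 1 sum'
        by (auto simp: scaleR_fun_def slice_def cyc_def algebra_simps)
    next
      case 2
      then have "w i = ?n" using permutes_not_in[OF w] by simp
      then show ?thesis using 2 c(3) k by (simp add: scaleR_fun_def cyc_def)
    next
      case 3
      then show ?thesis by (auto simp: scaleR_fun_def algebra_simps)
    qed
  qed
  moreover have "convex (permutohedron ?n x)" by (simp add: permutohedron_def convex_convex_hull)
  ultimately show ?thesis using V k c by (auto intro: convexD)
qed

lemma majorized_last_bounds:
  assumes "t \<in> majorized (Suc (Suc m)) x"
  shows "x (Suc (Suc m)) \<le> t (Suc (Suc m))" "t (Suc (Suc m)) \<le> x 1"
proof -
  have le: "sum t I \<le> psum x (card I)" if "I \<subseteq> {1..Suc (Suc m)}" for I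
    using assms that by (simp add: majorized_def)
  show "t (Suc (Suc m)) \<le> x 1" using le[of "{Suc (Suc m)}"] by (simp add: psum_def)
  have "sum t {1..Suc m} \<le> psum x (Suc m)" using le[of "{1..Suc m}"] by auto
  then show "x (Suc (Suc m)) \<le> t (Suc (Suc m))"
    using assms by (simp add: majorized_def)
qed

text \<open>The bounds for \<open>I\<close> and for \<open>insert (Suc m) I\<close> together bound
  the sum over \<open>I\<close> by the minimum in \<open>psum_slice_eq_min\<close>.\<close>

lemma majorized_slice:
  assumes x: "antimono_on {1..Suc m} x" and k: "k < m"
    and t: "t \<in> majorized (Suc m) x" and s: "t (Suc m) \<in> {x (Suc (Suc k))..x (Suc k)}"
  shows "restrict t {1..m} \<in> majorized m (slice (Suc k) (t (Suc m)) x)"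
proof -
  have le: "sum t I \<le> psum x (card I)" if "I \<subseteq> {1..Suc m}" for I
    using t that by (simp add: majorized_def)
  have "sum (restrict t {1..m}) I \<le> psum (slice (Suc k) (t (Suc m)) x) (card I)" if I: "I \<subseteq> {1..m}" for I
  proof -
    have fin: "finite I" and n: "Suc m \<notin> I" using I finite_subset by auto
    have "card I \<le> m" using card_mono[OF _ I] by simp
    moreover have "sum t I \<le> psum x (card I)" using I le[of I] by fastforce
    moreover have "sum t (insert (Suc m) I) \<le> psum x (card (insert (Suc m) I))"
      using I le[of "insert (Suc m) I"] by fastforce
    moreover have "sum (restrict t {1..m}) I = sum t I" using I by (intro sum.cong) auto
    ultimately show ?thesis using psum_slice_eq_min[OF x k s] fin n by simp
  qed
  moreover have "sum (restrict t {1..m}) {1..m} = psum (slice (Suc k) (t (Suc m)) x) m"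
    using t k by (simp add: psum_slice majorized_def)
  ultimately show ?thesis by (simp add: majorized_def)
qed

text \<open>The harder inclusion goes by induction on the dimension: drop the last coordinate
  \<open>s\<close>, apply the induction hypothesis to the slice, and append \<open>s\<close>
  again.\<close>

lemma permutohedron_eq_majorized:
  assumes "antimono_on {1..Suc m} x"
  shows "permutohedron (Suc m) x = majorized (Suc m) x"
proof
  show "permutohedron (Suc m) x \<subseteq> majorized (Suc m) x"
    using permutohedron_subset_majorized assms by blast
  show "majorized (Suc m) x \<subseteq> permutohedron (Suc m) x"
    using assms
  proof (induction m arbitrary: x)
    case 0
    show ?case
    proof
      fix t assume "t \<in> majorized (Suc 0) x"
      then have "t = (\<lambda>i\<in>{1..Suc 0}. x (id i))"
        by (auto simp: majorized_def PiE_iff extensional_def fun_eq_iff)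
      then show "t \<in> permutohedron (Suc 0) x"
        unfolding permutohedron_def using permutes_id by (blast intro: hull_inc)
    qed
  next
    case (Suc m)
    show ?case
    proof
      fix t assume t: "t \<in> majorized (Suc (Suc m)) x"
      define s where "s = t (Suc (Suc m))"
      obtain k where k: "k \<le> m" "s \<in> {x (Suc (Suc k))..x (Suc k)}"
        using interval_exists majorized_last_bounds[OF t] unfolding s_def by blast
      let ?y = "slice (Suc k) s x"
      have "restrict t {1..Suc m} \<in> majorized (Suc m) ?y"
        using majorized_slice[OF Suc.prems _ t] k unfolding s_def by simp
      also have "\<dots> \<subseteq> permutohedron (Suc m) ?y"
        using Suc.prems k by (intro Suc.IH slice_antimono) auto
      \<comment> \<open>Appending \<open>s\<close> respects convex combinations, so it suffices to
        check the vertices of the smaller permutohedron.\<close>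
      also have "\<dots> \<subseteq> {u. u(Suc (Suc m) := s) \<in> permutohedron (Suc (Suc m)) x}"
        unfolding permutohedron_def[of "Suc m"]
      proof (rule hull_minimal)
        show "{\<lambda>i\<in>{1..Suc m}. ?y (w i) |w. w permutes {1..Suc m}} \<subseteq>
            {u. u(Suc (Suc m) := s) \<in> permutohedron (Suc (Suc m)) x}"
          using slice_extended_vertex k by blast
        show "convex {u. u(Suc (Suc m) := s) \<in> permutohedron (Suc (Suc m)) x}"
        proof (rule convexI, rule CollectI)
          fix u v :: "nat \<Rightarrow> real" and a b :: real
          assume *: "u \<in> {u. u(Suc (Suc m) := s) \<in> permutohedron (Suc (Suc m)) x}"
            "v \<in> {u. u(Suc (Suc m) := s) \<in> permutohedron (Suc (Suc m)) x}" "0 \<le> a" "0 \<le> b" "a + b = 1"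
          have "(a *\<^sub>R u + b *\<^sub>R v)(Suc (Suc m) := s) =
            a *\<^sub>R u(Suc (Suc m) := s) + b *\<^sub>R v(Suc (Suc m) := s)"
            using *(5) by (auto simp: fun_eq_iff scaleR_fun_def simp flip: distrib_right)
          then show "(a *\<^sub>R u + b *\<^sub>R v)(Suc (Suc m) := s) \<in> permutohedron (Suc (Suc m)) x"
            using * by (auto simp: permutohedron_def intro!: convexD[OF convex_convex_hull])
        qed
      qed
      finally have "(restrict t {1..Suc m})(Suc (Suc m) := s) \<in> permutohedron (Suc (Suc m)) x" by simp
      moreover have "(restrict t {1..Suc m})(Suc (Suc m) := s) = t"
        using t by (auto simp: fun_eq_iff s_def majorized_def PiE_iff extensional_def)
      ultimately show "t \<in> permutohedron (Suc (Suc m)) x" by simp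
    qed
  qed
qed

subsection \<open>Volume of the projected permutohedron\<close>

text \<open>
  The lower bound on \<open>sum t I\<close> is the upper bound for the complement of \<open>I\<close> in \<open>{1..Suc m}\<close>,
  with the omitted coordinate eliminated through the total sum.
\<close>

definition region :: "nat \<Rightarrow> (nat \<Rightarrow> real) \<Rightarrow> (nat \<Rightarrow> real) set" where
  "region m x = {t \<in> {1..m} \<rightarrow>\<^sub>E UNIV. \<forall>I\<subseteq>{1..m}.
     psum x (Suc m) - psum x (Suc m - card I) \<le> sum t I \<and> sum t I \<le> psum x (card I)}"

lemma restrict_majorized: "(\<lambda>t. restrict t {1..m}) ` majorized (Suc m) x = region m x"
proof (intro equalityI subsetI)
  fix u assume "u \<in> (\<lambda>t. restrict t {1..m}) ` majorized (Suc m) x"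
  then obtain t where t: "t \<in> majorized (Suc m) x" and u: "u = restrict t {1..m}" by blast
  have le: "sum t I \<le> psum x (card I)" if "I \<subseteq> {1..Suc m}" for I
    using t that by (simp add: majorized_def)
  have "psum x (Suc m) - psum x (Suc m - card I) \<le> sum u I \<and> sum u I \<le> psum x (card I)"
    if I: "I \<subseteq> {1..m}" for I
  proof -
    have I': "I \<subseteq> {1..Suc m}" using I by auto
    have "sum u I = sum t I" using I by (auto simp: u intro!: sum.cong)
    moreover have "sum t I = psum x (Suc m) - sum t ({1..Suc m} - I)"
      using t I' sum.subset_diff[OF I', of t] by (simp add: majorized_def)
    moreover have "card ({1..Suc m} - I) = Suc m - card I"
      using I' by (subst card_Diff_subset) (auto dest: finite_subset)
    ultimately show ?thesis using le[of "{1..Suc m} - I"] le[OF I'] by auto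
  qed
  then show "u \<in> region m x" by (simp add: region_def u)
next
  fix u assume u: "u \<in> region m x"
  \<comment> \<open>The total sum forces this last coordinate.\<close>
  define t where "t = u(Suc m := psum x (Suc m) - sum u {1..m})"
  have eq: "sum t I = sum u I" if "I \<subseteq> {1..m}" for I
    using that by (intro sum.cong) (auto simp: t_def)
  have "sum t I \<le> psum x (card I)" if I: "I \<subseteq> {1..Suc m}" for I
  proof (cases "Suc m \<in> I")
    case False
    then have "I \<subseteq> {1..m}" using I by (auto simp: le_Suc_eq subset_iff)
    then show ?thesis using u eq by (simp add: region_def)
  next
    case True
    define I' where "I' = I - {Suc m}"
    have I': "I = insert (Suc m) I'" "Suc m \<notin> I'" "I' \<subseteq> {1..m}" using True I
      by (auto simp: I'_def)
    have fin: "finite I'" using I' finite_subset by blast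
    have card: "card ({1..m} - I') = m - card I'" "card I' \<le> m"
      using I' fin card_mono[of "{1..m}" I'] by (auto simp: card_Diff_subset)
    \<comment> \<open>The upper bound for \<open>I\<close> comes from the lower bound for its
      complement, which avoids the last index.\<close>
    have "psum x (Suc m) - psum x (Suc m - card ({1..m} - I')) \<le> sum u ({1..m} - I')"
      using u by (simp add: region_def)
    moreover have "Suc m - card ({1..m} - I') = card I" using card I' fin by simp
    moreover have "sum u {1..m} = sum u ({1..m} - I') + sum u I'"
      using I' by (intro sum.subset_diff) auto
    moreover have "sum t I = psum x (Suc m) - sum u {1..m} + sum u I'"
      using I' fin eq by (simp add: t_def)
    ultimately show ?thesis by simp
  qed
  moreover have "sum t {1..Suc m} = psum x (Suc m)"
    using eq[of "{1..m}"] by (simp add: t_def)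
  moreover have "t \<in> {1..Suc m} \<rightarrow>\<^sub>E UNIV"
    using u by (auto simp: t_def region_def PiE_iff extensional_def)
  ultimately have "t \<in> majorized (Suc m) x" by (simp add: majorized_def)
  moreover have "u = restrict t {1..m}"
    using u by (auto simp: t_def region_def PiE_iff extensional_def fun_eq_iff)
  ultimately show "u \<in> (\<lambda>t. restrict t {1..m}) ` majorized (Suc m) x" by blast
qed

section \<open>Slices of the projected region\<close>

lemma all_subset_insert_iff: "(\<forall>I\<subseteq>insert a A. P I) \<longleftrightarrow> (\<forall>I\<subseteq>A. P I \<and> P (insert a I))"
proof
  assume *: "\<forall>I\<subseteq>A. P I \<and> P (insert a I)"
  show "\<forall>I\<subseteq>insert a A. P I"
  proof clarify
    fix I assume "I \<subseteq> insert a A"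
    then show "P I" using *[rule_format, of "I - {a}"] by (cases "a \<in> I") (auto simp: insert_absorb)
  qed
next
  assume *: "\<forall>I\<subseteq>insert a A. P I"
  show "\<forall>I\<subseteq>A. P I \<and> P (insert a I)"
    using *[rule_format, OF insert_mono] *[rule_format, OF subset_insertI2] by blast
qed

text \<open>Each \<open>I\<close> within \<open>{1..m}\<close> is paired with
  \<open>insert (Suc m) I\<close>. By the formula with \<open>min\<close>, their two upper bounds
  merge into one for the slice, and so do their two lower bounds.\<close>

lemma region_fun_upd_iff:
  assumes x: "antimono_on {1..Suc (Suc m)} x" and k: "k \<le> m" and s: "s \<in> {x (Suc (Suc k))..x (Suc k)}"
    and u: "u \<in> {1..m} \<rightarrow>\<^sub>E UNIV"
  shows "u(Suc m := s) \<in> region (Suc m) x \<longleftrightarrow> u \<in> region m (slice (Suc k) s x)"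
proof -
  let ?n = "Suc (Suc m)" and ?y = "slice (Suc k) s x"
  have ext: "u(Suc m := s) \<in> {1..Suc m} \<rightarrow>\<^sub>E UNIV"
    using u by (auto simp: PiE_iff extensional_def)
  have "u(Suc m := s) \<in> region (Suc m) x \<longleftrightarrow> (\<forall>I\<subseteq>insert (Suc m) {1..m}.
     psum x ?n - psum x (?n - card I) \<le> sum (u(Suc m := s)) I \<and> sum (u(Suc m := s)) I \<le> psum x (card I))"
    unfolding region_def using ext by (simp add: atLeastAtMostSuc_conv)
  also have "\<dots> \<longleftrightarrow> (\<forall>I\<subseteq>{1..m}.
     psum ?y (Suc m) - psum ?y (Suc m - card I) \<le> sum u I \<and> sum u I \<le> psum ?y (card I))"
    unfolding all_subset_insert_iff
  proof (intro all_cong1 imp_cong refl)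
    fix I assume I: "I \<subseteq> {1..m}"
    have fin: "finite I" and n: "Suc m \<notin> I" using I finite_subset by auto
    have c: "card I \<le> m" using card_mono[OF _ I] by simp
    have sums: "sum (u(Suc m := s)) I = sum u I" using n by (intro sum.cong) auto
    have sums': "sum (u(Suc m := s)) (insert (Suc m) I) = s + sum u I" using n fin sums by simp
    have card': "card (insert (Suc m) I) = Suc (card I)" using n fin by simp
    have y: "psum ?y j = min (psum x j) (psum x (Suc j) - s)" if "j \<le> Suc m" for j
      using psum_slice_eq_min[OF x _ s that] k by simp
    have total: "psum ?y (Suc m) = psum x ?n - s" using k by (subst psum_slice) simp
    have "?n - card I = Suc (Suc m - card I)" using c by simp
    then show "(psum x ?n - psum x (?n - card I) \<le> sum (u(Suc m := s)) I \<and> sum (u(Suc m := s)) I \<le> psum x (card I)) \<and>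
      psum x ?n - psum x (?n - card (insert (Suc m) I)) \<le> sum (u(Suc m := s)) (insert (Suc m) I) \<and>
      sum (u(Suc m := s)) (insert (Suc m) I) \<le> psum x (card (insert (Suc m) I)) \<longleftrightarrow>
      psum ?y (Suc m) - psum ?y (Suc m - card I) \<le> sum u I \<and> sum u I \<le> psum ?y (card I)"
      unfolding sums sums' card' total using c y[of "Suc m - card I"] y[of "card I"]
      by (auto simp: min_def algebra_simps simp del: psum_Suc)
  qed
  also have "\<dots> \<longleftrightarrow> u \<in> region m ?y" using u by (simp add: region_def del: psum_Suc)
  finally show ?thesis .
qed

lemma region_last_bounds:
  assumes "t \<in> region (Suc m) x"
  shows "x (Suc (Suc m)) \<le> t (Suc m)" "t (Suc m) \<le> x 1"
proof -
  have "psum x (Suc (Suc m)) - psum x (Suc (Suc m) - card {Suc m}) \<le> sum t {Suc m} \<and>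
    sum t {Suc m} \<le> psum x (card {Suc m})"
    using assms unfolding region_def by (elim CollectE conjE allE[of _ "{Suc m}"]) auto
  then show "x (Suc (Suc m)) \<le> t (Suc m)" "t (Suc m) \<le> x 1" by (simp_all add: psum_def)
qed

section \<open>Integration over the last coordinate\<close>

lemma region_measurable [measurable]: "region m x \<in> sets (Pi\<^sub>M {1..m} (\<lambda>_. lborel))"
proof -
  have "region m x = {t \<in> space (Pi\<^sub>M {1..m} (\<lambda>_. lborel)). \<forall>I\<in>Pow {1..m}.
     psum x (Suc m) - psum x (Suc m - card I) \<le> sum t I \<and> sum t I \<le> psum x (card I)}"
    by (auto simp: region_def space_PiM)
  also have "\<dots> \<in> sets (Pi\<^sub>M {1..m} (\<lambda>_. lborel))"
    by (intro sets.sets_Collect_finite_All)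
       (auto intro!: sets.sets_Collect_conj borel_measurable_le borel_measurable_sum measurable_component_singleton)
  finally show ?thesis .
qed

lemma emeasure_region_Suc:
  "emeasure (Pi\<^sub>M {1..Suc m} (\<lambda>_. lborel)) (region (Suc m) x) =
   (\<integral>\<^sup>+s. emeasure (Pi\<^sub>M {1..m} (\<lambda>_. lborel)) {u \<in> {1..m} \<rightarrow>\<^sub>E UNIV. u(Suc m := s) \<in> region (Suc m) x} \<partial>lborel)"
proof -
  interpret product_sigma_finite "\<lambda>_::nat. lborel :: real measure"
    by (simp add: product_sigma_finite_def sigma_finite_lborel)
  let ?M = "\<lambda>m::nat. Pi\<^sub>M {1..m} (\<lambda>_. lborel :: real measure)"
  have ins: "{1..Suc m} = insert (Suc m) {1..m}" by auto
  have "emeasure (?M (Suc m)) (region (Suc m) x) = (\<integral>\<^sup>+t. indicator (region (Suc m) x) t \<partial>?M (Suc m))"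
    by (rule nn_integral_indicator[OF region_measurable, symmetric])
  also have "\<dots> = (\<integral>\<^sup>+s. \<integral>\<^sup>+u. indicator (region (Suc m) x) (u(Suc m := s)) \<partial>?M m \<partial>lborel)"
    unfolding ins
    by (rule product_nn_integral_insert_rev, simp, simp, unfold ins[symmetric],
        rule borel_measurable_indicator[OF region_measurable])
  also have "\<dots> = (\<integral>\<^sup>+s. emeasure (?M m) {u \<in> {1..m} \<rightarrow>\<^sub>E UNIV. u(Suc m := s) \<in> region (Suc m) x} \<partial>lborel)"
  proof (intro nn_integral_cong)
    fix s :: real
    let ?A = "{u \<in> {1..m} \<rightarrow>\<^sub>E UNIV. u(Suc m := s) \<in> region (Suc m) x}"
    have "(\<lambda>u. u(Suc m := s)) \<in> measurable (?M m) (?M (Suc m))"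
      unfolding ins by (rule measurable_fun_upd[where J="{1..m}"]) auto
    then have "(\<lambda>u. u(Suc m := s)) -` region (Suc m) x \<inter> space (?M m) \<in> sets (?M m)"
      by (rule measurable_sets[OF _ region_measurable])
    also have "(\<lambda>u. u(Suc m := s)) -` region (Suc m) x \<inter> space (?M m) = ?A"
      by (auto simp: space_PiM)
    finally have A: "?A \<in> sets (?M m)" .
    have "(\<integral>\<^sup>+u. indicator (region (Suc m) x) (u(Suc m := s)) \<partial>?M m) = (\<integral>\<^sup>+u. indicator ?A u \<partial>?M m)"
      by (intro nn_integral_cong) (auto simp: space_PiM indicator_def)
    then show "(\<integral>\<^sup>+u. indicator (region (Suc m) x) (u(Suc m := s)) \<partial>?M m) = emeasure (?M m) ?A"
      by (simp only: nn_integral_indicator[OF A])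
  qed
  finally show ?thesis .
qed

lemma perm_sum_slice_measurable [measurable]:
  "(\<lambda>s. perm_sum j (slice k s x) L) \<in> borel_measurable borel"
proof -
  have [measurable]: "(\<lambda>s. slice k s x i) \<in> borel_measurable borel" for i
    by (cases i k rule: linorder_cases) (simp_all add: slice_def)
  show ?thesis unfolding perm_sum_def dot_def by measurable
qed

text \<open>Induction on the dimension with \<open>x\<close> and \<open>L\<close> general, since the
  step changes both. Nonnegativity is carried along because \<open>ennreal\<close> sends negative
  reals to 0; it also makes the integrands of the next step nonnegative.\<close>

lemma emeasure_region:
  assumes "antimono_on {1..Suc m} x" "finite L" "card L = Suc m"
  shows "0 \<le> perm_sum m x L \<and>
    emeasure (Pi\<^sub>M {1..m} (\<lambda>_. lborel)) (region m x) = ennreal (perm_sum m x L / fact m)"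
  using assms
proof (induction m arbitrary: x L)
  case 0
  then obtain a where L: "L = {a}" by (auto simp: card_Suc_eq)
  have "region 0 x = {\<lambda>_. undefined}" by (auto simp: region_def psum_def)
  then show ?case by (simp add: L perm_sum_def PiM_empty)
next
  case (Suc m)
  let ?M = "Pi\<^sub>M {1..m} (\<lambda>_. lborel :: real measure)"
  obtain a where a: "a \<in> L" using Suc.prems(3) by (metis card.empty equals0I nat.distinct(1))
  define L' where "L' = (+) (-a) ` (L - {a})"
  have L': "finite L'" "card L' = Suc m" "0 \<notin> L'"
    using Suc.prems a by (auto simp: L'_def card_image)
  have ins: "insert 0 L' = (+) (-a) ` L" using a by (auto simp: L'_def)
  have "L' \<noteq> {}" using L' by auto
  then have rec: "perm_sum (Suc m) x L = (\<Sum>k\<le>m.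
      slice_primitive (Suc m) x L' k (x (Suc k)) - slice_primitive (Suc m) x L' k (x (Suc (Suc k))))"
    using perm_sum_insert_zero[OF L'(1) _ L'(3), of "Suc m" x]
    unfolding L'(2) ins perm_sum_shift_top[OF Suc.prems(2,3)] lessThan_Suc_atMost by blast
  define f where "f k s = perm_sum m (slice (Suc k) s x) L' / fact m" for k s
  \<comment> \<open>The factor \<open>Suc m\<close> from differentiation cancels against
    \<open>fact (Suc m)\<close>, so \<open>F k\<close> is a primitive of \<open>f k\<close>.\<close>
  define F where "F k s = slice_primitive (Suc m) x L' k s / fact (Suc m)" for k s
  define J where "J k = {x (Suc (Suc k))..x (Suc k)}" for k
  have x: "x j \<le> x i" if "1 \<le> i" "i \<le> j" "j \<le> Suc (Suc m)" for i j
    using that by (intro monotone_onD[OF Suc.prems(1)]) auto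
  have f: "0 \<le> f k s" "emeasure ?M (region m (slice (Suc k) s x)) = ennreal (f k s)"
    if "k \<le> m" "s \<in> J k" for k s
    using Suc.IH[OF slice_antimono[OF Suc.prems(1), of k s] L'(1,2)] that by (simp_all add: f_def J_def)
  have deriv: "(F k has_real_derivative f k s) (at s)" if "k \<le> m" for k s
  proof -
    have "(F k has_real_derivative (real (Suc m) * perm_sum m (slice (Suc k) s x) L') / fact (Suc m)) (at s)"
      unfolding F_def[abs_def] using slice_primitive_has_derivative[OF L'(1,3), of k "Suc m" x s] L'(2) that
      by (intro DERIV_cdivide) simp
    moreover have "(real (Suc m) * perm_sum m (slice (Suc k) s x) L') / fact (Suc m) = f k s"
      unfolding f_def fact_Suc by (simp del: of_nat_Suc)
    ultimately show ?thesis by simp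
  qed
  have le: "x (Suc (Suc k)) \<le> x (Suc k)" if "k \<le> m" for k
    using x[of "Suc k" "Suc (Suc k)"] that by simp
  have F_mono: "F k (x (Suc (Suc k))) \<le> F k (x (Suc k))" if k: "k \<le> m" for k
  proof (rule DERIV_nonneg_imp_nondecreasing[OF le[OF k]])
    fix s assume "x (Suc (Suc k)) \<le> s" "s \<le> x (Suc k)"
    then show "\<exists>y. (F k has_real_derivative y) (at s) \<and> 0 \<le> y"
      using deriv[OF k] f(1)[OF k, of s] unfolding J_def by (intro exI[of _ "f k s"] conjI) simp_all
  qed
  have piece: "(\<integral>\<^sup>+s. ennreal (f k s) * indicator (J k) s \<partial>lborel) = ennreal (F k (x (Suc k)) - F k (x (Suc (Suc k))))"
    if k: "k \<le> m" for k
    unfolding J_def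
  proof (rule nn_integral_FTC_Icc)
    show "f k \<in> borel_measurable borel" unfolding f_def[abs_def] by measurable
  qed (use k f(1) deriv le in \<open>simp_all add: J_def\<close>)
  \<comment> \<open>Adjacent closed intervals share an endpoint. Away from the finitely many entries
    of \<open>x\<close>, at most one summand is nonzero.\<close>
  have integrand: "emeasure ?M {u \<in> {1..m} \<rightarrow>\<^sub>E UNIV. u(Suc m := s) \<in> region (Suc m) x} =
      (\<Sum>k\<le>m. ennreal (f k s) * indicator (J k) s)" if s: "s \<notin> x ` {1..Suc (Suc m)}" for s
  proof (cases "\<exists>k\<le>m. s \<in> J k")
    case True
    then obtain k where k: "k \<le> m" "s \<in> J k" by blast
    have "{u \<in> {1..m} \<rightarrow>\<^sub>E UNIV. u(Suc m := s) \<in> region (Suc m) x} = region m (slice (Suc k) s x)"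
      using region_fun_upd_iff[OF Suc.prems(1) k(1), of s] k(2)
      unfolding J_def region_def[of m] by blast
    moreover have "s \<notin> J k'" if k': "k' \<le> m" "k' \<noteq> k" for k'
    proof
      assume *: "s \<in> J k'"
      have ne: "s \<noteq> x (Suc j)" if "j \<le> Suc m" for j using s that by force
      show False
      proof (cases "k < k'")
        case True
        then show False using x[of "Suc (Suc k)" "Suc k'"] k k' * ne[of "Suc k"] unfolding J_def by simp
      next
        case False
        then show False using x[of "Suc (Suc k')" "Suc k"] k k' * ne[of k] unfolding J_def by simp
      qed
    qed
    then have "(\<Sum>k'\<le>m. ennreal (f k' s) * indicator (J k') s) = (\<Sum>k'\<le>m. if k' = k then ennreal (f k s) else 0)"
      using k by (intro sum.cong) auto
    ultimately show ?thesis using f(2)[OF k] k by simp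
  next
    case False
    \<comment> \<open>Outside all intervals \<open>s\<close> lies beyond the extreme entries of
      \<open>x\<close>, where the slice is empty.\<close>
    have "u(Suc m := s) \<notin> region (Suc m) x" for u
      using region_last_bounds[of "u(Suc m := s)" m x] interval_exists[of x m s] False by (auto simp: J_def)
    then show ?thesis using False by (simp add: indicator_def)
  qed
  have "emeasure (Pi\<^sub>M {1..Suc m} (\<lambda>_. lborel)) (region (Suc m) x) =
      (\<integral>\<^sup>+s. (\<Sum>k\<le>m. ennreal (f k s) * indicator (J k) s) \<partial>lborel)"
    unfolding emeasure_region_Suc
  proof (rule nn_integral_cong_AE)
    have "AE s in lborel. s \<notin> x ` {1..Suc (Suc m)}"
      by (rule AE_not_in) (intro finite_imp_null_set_lborel finite_imageI finite_atLeastAtMost)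
    then show "AE s in lborel. emeasure ?M {u \<in> {1..m} \<rightarrow>\<^sub>E UNIV. u(Suc m := s) \<in> region (Suc m) x} =
      (\<Sum>k\<le>m. ennreal (f k s) * indicator (J k) s)"
      by eventually_elim (rule integrand)
  qed
  also have "\<dots> = (\<Sum>k\<le>m. \<integral>\<^sup>+s. ennreal (f k s) * indicator (J k) s \<partial>lborel)"
    by (rule nn_integral_sum) (simp add: f_def J_def)
  also have "\<dots> = (\<Sum>k\<le>m. ennreal (F k (x (Suc k)) - F k (x (Suc (Suc k)))))"
    using piece by (intro sum.cong) auto
  also have "\<dots> = ennreal (\<Sum>k\<le>m. F k (x (Suc k)) - F k (x (Suc (Suc k))))"
    using F_mono by (intro sum_ennreal) auto
  also have eq: "(\<Sum>k\<le>m. F k (x (Suc k)) - F k (x (Suc (Suc k)))) = perm_sum (Suc m) x L / fact (Suc m)"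
    unfolding rec F_def diff_divide_distrib[symmetric] sum_divide_distrib ..
  finally have "emeasure (Pi\<^sub>M {1..Suc m} (\<lambda>_. lborel)) (region (Suc m) x) = ennreal (perm_sum (Suc m) x L / fact (Suc m))" .
  moreover have "0 \<le> perm_sum (Suc m) x L / fact (Suc m)"
    unfolding eq[symmetric] using F_mono by (intro sum_nonneg) auto
  ultimately show ?case by (metis divide_less_0_iff fact_gt_zero not_le)
qed

theorem theorem3p1:
  fixes n :: nat and x l :: "nat \<Rightarrow> real"
  assumes "n \<ge> 1"
    and "\<And>i j. 1 \<le> i \<Longrightarrow> i \<le> j \<Longrightarrow> j \<le> n \<Longrightarrow> x j \<le> x i"
    and "inj_on l {1..n}"
  shows "proj_volume n (permutohedron n x) =
    1 / fact (n - 1) *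
    (\<Sum>w | w permutes {1..n}.
       (\<Sum>i=1..n. l (w i) * x i) ^ (n - 1) /
       (\<Prod>i=1..<n. l (w i) - l (w (i + 1))))"
proof -
  obtain m where n: "n = Suc m" using assms(1) by (cases n) auto
  have x: "antimono_on {1..Suc m} x" using assms(2) n by (auto intro: monotone_onI)
  have "card (l ` {1..n}) = Suc m" using assms(3) by (simp add: card_image n)
  then have "0 \<le> perm_sum m x (l ` {1..n})"
    "emeasure (Pi\<^sub>M {1..m} (\<lambda>_. lborel)) (region m x) = ennreal (perm_sum m x (l ` {1..n}) / fact m)"
    using emeasure_region[OF x, of "l ` {1..n}"] by simp_all
  moreover have "{1..<n} = {1..m}" by (auto simp: n)
  \<comment> \<open>The projected permutohedron is \<open>region m x\<close>; nonnegativity allows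
    passing from \<open>emeasure\<close> to the real-valued \<open>measure\<close>.\<close>
  ultimately have "proj_volume n (permutohedron n x) = perm_sum m x (l ` {1..n}) / fact m"
    unfolding proj_volume_def n permutohedron_eq_majorized[OF x]
    by (simp add: restrict_majorized[unfolded One_nat_def] measure_def n)
  then show ?thesis unfolding perm_sum_eq_sum_permutes[OF assms(3)] by (simp add: n)
qed

end
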